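(* Let $i$ be an agent for which: (1) $\alpha_i^1(z)=\alpha_i^1z$ and $\alpha_i^2(z)=\alpha_i^2z$ with constants $\alpha_i^1,\alpha_i^2>0$; (2) $\mathcal L_{\bar g_i}^2\phi_{i,o}^1(x_i,x_o)=\mathbf 0^{M_i\times M_i}$ for all $o\in\mathcal O_i$; (3) $\mathcal U_i^s=\{u\in\mathbb R^{M_i}:G_iu-l_i\le\mathbf 0\}$ is a non-empty convex set, with $G_i\in\mathbb R^{Y_i\times M_i}$, $l_i\in\mathbb R^{Y_i}$. Then the optimal solution of the max-min problem $$u_i^*=\arg\max_{u_i^s\in\mathcal U_i^s}\ \min_{1\le k\le|\mathcal O_i|}[B_iu_i^s]_k,\qquad \gamma_i^*=\max_{u_i^s\in\mathcal U_i^s}\ \min_{1\le k\le|\mathcal O_i|}[B_iu_i^s]_k$$ exists if and only if there exists an optimal solution $\xi_i^{( * )}=\begin{bmatrix}\gamma_i^{( * )}&{u_i^{( * )}}^\top\end{bmatrix}^\top$ of the linear program $$\min_{\xi_i}\ d^\top\xi_i\quad\text{s.t.}\quad\begin{bmatrix}\mathbf 0&G_i\\ \mathbf 1&-B_i\end{bmatrix}\xi_i-\begin{bmatrix}l_i\\ \mathbf 0\end{bmatrix}\le\mathbf 0,\qquad d^\top=\begin{bmatrix}-1&\mathbf 0_{M_i}^\top\end{bmatrix},\quad \xi_i^\top=\begin{bmatrix}\gamma_i&u_i^{s\top}\end{bmatrix},$$ and $\gamma_i^{( * )}=\gamma_i^*$, $u_i^{( * )}=u_i^*$.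
   Context: $[v]_k$ is the $k$-th entry of a vector $v$; vector inequalities are elementwise; $\mathbf 0,\mathbf 1$ are all-zeros/all-ones blocks of appropriate size. $\mathcal O_i$ is a finite nonempty set of obstacles for agent $i$. Optimizers need not be unique: $u_i^{( * )}=u_i^*$ means that the $u$-components of optimal solutions of the linear program are maximizers of the max-min problem and vice versa. The matrix $B_i\in\mathbb R^{|\mathcal O_i|\times M_i}$ is evaluated at a fixed state and has rows, for $o\in\mathcal O_i$, $\mathcal L_{\bar f_i}\mathcal L_{\bar g_i}\phi_{i,o}^{1\top}+\mathcal L_{\bar g_i}\mathcal L_{\bar f_i}\phi_{i,o}^1+\beta_i\mathcal L_{\bar g_i}\phi_{i,o}^1$, where $\beta_i=\alpha_i^1+\alpha_i^2$. Here agent $i$ has dynamics $\dot x_i=\bar f_i(x_i,x_{\mathcal N_i})+\bar g_i(x_i)u_i^s$ ($x_{\mathcal N_i}$: neighbours' states; $u_i^s\in\mathbb R^{M_i}$: control), $\phi_{i,o}^1=\dot h_{i,o}+\alpha_i^0(h_{i,o})$ for a position-based safety function $h_{i,o}(x_i,x_o)$ with respect to obstacle $o$ of state $x_o$ and a class-$\mathcal K$ function $\alpha_i^0$, and $\mathcal L_{\bar f_i}F=\frac{\partial F}{\partial x_i}\bar f_i$, $\mathcal L_{\bar g_i}F=\frac{\partial F}{\partial x_i}\bar g_i$. *)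

theory Defs
  imports "HOL-Analysis.Analysis"
begin

definition class_K :: "(real \<Rightarrow> real) \<Rightarrow> bool" where
  "class_K \<alpha> \<longleftrightarrow> continuous_on {0..} \<alpha> \<and> strict_mono_on {0..} \<alpha> \<and> \<alpha> 0 = 0"

(* (dF/dx) f(x), for scalar- and vector-valued F *)
definition lie_drift ::
  "('a::real_normed_vector \<Rightarrow> 'a) \<Rightarrow> ('a \<Rightarrow> 'b::real_normed_vector) \<Rightarrow> 'a \<Rightarrow> 'b" where
  "lie_drift f F x = frechet_derivative F (at x) (f x)"

(* (dF/dx) g(x) for scalar F: a row vector with one entry per control input *)
definition lie_ctrl ::
  "(real^'n \<Rightarrow> real^'m^'n) \<Rightarrow> (real^'n \<Rightarrow> real) \<Rightarrow> real^'n \<Rightarrow> real^'m" where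
  "lie_ctrl g F x = (\<chi> j. frechet_derivative F (at x) (column j (g x)))"

definition lie_ctrl_vec ::
  "(real^'n \<Rightarrow> real^'m^'n) \<Rightarrow> (real^'n \<Rightarrow> real^'k) \<Rightarrow> real^'n \<Rightarrow> real^'m^'k" where
  "lie_ctrl_vec g F x = jacobian F (at x) ** g x"

definition lie_ctrl2 ::
  "(real^'n \<Rightarrow> real^'m^'n) \<Rightarrow> (real^'n \<Rightarrow> real) \<Rightarrow> real^'n \<Rightarrow> real^'m^'m" where
  "lie_ctrl2 g F = lie_ctrl_vec g (lie_ctrl g F)"

(* Time derivative of h(x_i, x_o) along  x_i' = f(x_i, z) + g(x_i) u  and  x_o' = w(x_o),
   where z is the state of the neighbours. *)
definition h_dot ::
  "(real^'n \<Rightarrow> 'z \<Rightarrow> real^'n) \<Rightarrow> (real^'n \<Rightarrow> real^'m^'n) \<Rightarrow> (real^'p \<Rightarrow> real^'p)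
    \<Rightarrow> (real^'n \<Rightarrow> real^'p \<Rightarrow> real) \<Rightarrow> 'z \<Rightarrow> real^'m \<Rightarrow> real^'n \<Rightarrow> real^'p \<Rightarrow> real" where
  "h_dot f g w h z u x y =
     lie_drift (\<lambda>x. f x z + g x *v u) (\<lambda>x. h x y) x + lie_drift w (h x) y"

(* Row k of B; all Lie derivatives act on the own state only, with the states xo of the
   obstacles and z of the neighbours held fixed. *)
definition B_matrix ::
  "(real^'n \<Rightarrow> 'z \<Rightarrow> real^'n) \<Rightarrow> (real^'n \<Rightarrow> real^'m^'n) \<Rightarrow> ('o \<Rightarrow> real^'n \<Rightarrow> real^'p \<Rightarrow> real)
    \<Rightarrow> real \<Rightarrow> 'z \<Rightarrow> real^'n \<Rightarrow> ('o \<Rightarrow> real^'p) \<Rightarrow> real^'m^'o" where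
  "B_matrix f g \<phi> \<beta> z x xo = (\<chi> k.
     let F = (\<lambda>x. \<phi> k x (xo k)); fz = (\<lambda>x. f x z)
     in lie_drift fz (lie_ctrl g F) x + lie_ctrl g (lie_drift fz F) x + \<beta> *\<^sub>R lie_ctrl g F x)"

definition min_entry :: "real^'k \<Rightarrow> real" where
  "min_entry v = (MIN k. v $ k)"

definition is_maximum :: "real set \<Rightarrow> real \<Rightarrow> bool" where
  "is_maximum S m \<longleftrightarrow> m \<in> S \<and> (\<forall>s\<in>S. s \<le> m)"

(* u is in the arg max, \<gamma> is the max *)
definition maxmin_optimal :: "(real^'m) set \<Rightarrow> real^'m^'k \<Rightarrow> real \<Rightarrow> real^'m \<Rightarrow> bool" where
  "maxmin_optimal U B \<gamma> u \<longleftrightarrow>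
     is_arg_max (\<lambda>u. min_entry (B *v u)) (\<lambda>u. u \<in> U) u \<and>
     is_maximum ((\<lambda>u. min_entry (B *v u)) ` U) \<gamma>"

definition block_vec :: "'a^'m \<Rightarrow> 'a^'n \<Rightarrow> 'a^('m + 'n)" where
  "block_vec a b = (\<chi> i. case i of Inl j \<Rightarrow> a $ j | Inr j \<Rightarrow> b $ j)"

definition block_mat ::
  "'a^'m^'k \<Rightarrow> 'a^'n^'k \<Rightarrow> 'a^'m^'l \<Rightarrow> 'a^'n^'l \<Rightarrow> 'a^('m + 'n)^('k + 'l)" where
  "block_mat A B C D =
     (\<chi> i. case i of Inl r \<Rightarrow> block_vec (A $ r) (B $ r) | Inr r \<Rightarrow> block_vec (C $ r) (D $ r))"

definition lp_optimal :: "real^'k \<Rightarrow> real^'k^'l \<Rightarrow> real^'l \<Rightarrow> real^'k \<Rightarrow> bool" where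
  "lp_optimal d A b = is_arg_min (\<lambda>\<xi>. d \<bullet> \<xi>) (\<lambda>\<xi>. A *v \<xi> - b \<le> 0)"

end

theory Submission
  imports Defs
begin

text \<open>For fixed \<open>u\<close> the largest \<open>\<gamma>\<close> satisfying the constraints is the smallest entry of
  \<open>B u\<close>, so the linear program maximizes \<open>\<gamma>\<close> over the hypograph of the max-min objective.\<close>

lemma block_vec_nth [simp]:
  "block_vec a b $ Inl j = a $ j" "block_vec a b $ Inr k = b $ k"
  by (simp_all add: block_vec_def)

lemma block_vec_surj: "\<exists>a b. v = block_vec a b"
proof -
  have "v = block_vec (\<chi> j. v $ Inl j) (\<chi> k. v $ Inr k)"
    by (simp add: vec_eq_iff block_vec_def split: sum.split)
  then show ?thesis
    by blast
qed

text \<open>The scalar variable \<gamma> enters the linear program as a block of length one;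
  together with \<open>block_vec_surj\<close> this lets every \<xi> be written as
  \<open>block_vec (vec \<gamma>) u\<close>.\<close>

lemma vec_1_surj: "\<exists>c. (v :: 'a^1) = vec c"
  by (metis (full_types) num1_eq1 vec_eq_iff vec_component)

lemma sum_UNIV_Plus:
  fixes f :: "'a::finite + 'b::finite \<Rightarrow> 'c::comm_monoid_add"
  shows "(\<Sum>i\<in>UNIV. f i) = (\<Sum>j\<in>UNIV. f (Inl j)) + (\<Sum>k\<in>UNIV. f (Inr k))"
  by (simp add: sum.Plus flip: UNIV_Plus_UNIV)

lemma inner_block_vec:
  fixes a a' :: "'a::real_inner^'m" and b b' :: "'a^'n"
  shows "block_vec a b \<bullet> block_vec a' b' = a \<bullet> a' + b \<bullet> b'"
  by (simp add: inner_vec_def sum_UNIV_Plus)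

lemma block_mat_mult_block_vec:
  fixes A :: "'a::semiring_1^'m^'k" and B :: "'a^'n^'k" and C :: "'a^'m^'l" and D :: "'a^'n^'l"
  shows "block_mat A B C D *v block_vec a b = block_vec (A *v a + B *v b) (C *v a + D *v b)"
  by (auto simp: vec_eq_iff matrix_vector_mult_def sum_UNIV_Plus block_mat_def block_vec_def
      split: sum.split)

lemma block_vec_le_iff:
  "block_vec a b \<le> block_vec a' b' \<longleftrightarrow> a \<le> a' \<and> b \<le> b'"
  by (auto simp: less_eq_vec_def block_vec_def split: sum.split)

lemma le_min_entry_iff: "c \<le> min_entry v \<longleftrightarrow> (\<forall>k. c \<le> v $ k)"
  by (auto simp: min_entry_def)

text \<open>The upper block row reads G u \<le> l. Row k of the lower one reads \<gamma> - [B u]_k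
  \<le> 0, and these inequalities for all k together bound \<gamma> by the smallest entry.\<close>

lemma lp_feasible_iff:
  fixes G :: "real^'m^'y" and B :: "real^'m^'o"
  shows "block_mat 0 G (\<chi> i j. 1) (- B) *v block_vec (vec \<gamma> :: real^1) u - block_vec l 0 \<le> 0
    \<longleftrightarrow> G *v u - l \<le> 0 \<and> \<gamma> \<le> min_entry (B *v u)"
proof -
  have "(- B) *v u = - (B *v u)"
    by (simp add: matrix_vector_mult_def vec_eq_iff sum_negf)
  moreover have "((\<chi> i j. 1) :: real^1^'o) *v vec \<gamma> = vec \<gamma>"
    by (simp add: matrix_vector_mult_def vec_eq_iff)
  ultimately show ?thesis
    \<comment> \<open>The vector order is unfolded only after the blocks have been separated,
      because an entrywise inequality no longer matches \<open>block_vec_le_iff\<close>.\<close>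
    by (simp add: block_mat_mult_block_vec block_vec_le_iff le_min_entry_iff)
      (simp add: less_eq_vec_def)
qed

text \<open>Matching the optimal pairs one by one covers non-unique optimizers and yields the
  equality of values and of maximizers at once.\<close>

lemma lp_optimal_iff_maxmin_optimal:
  fixes G :: "real^'m^'y" and B :: "real^'m^'o"
  shows "lp_optimal (block_vec (vec (-1)) 0) (block_mat 0 G (\<chi> i j. 1) (- B)) (block_vec l 0)
      (block_vec (vec \<gamma> :: real^1) u)
    \<longleftrightarrow> maxmin_optimal {u. G *v u - l \<le> 0} B \<gamma> u"
    (is "lp_optimal ?d ?A ?b _ \<longleftrightarrow> maxmin_optimal ?U B \<gamma> u")
proof -
  let ?m = "\<lambda>u. min_entry (B *v u)"
  have cost: "?d \<bullet> block_vec (vec t :: real^1) v = - t" for t v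
    by (simp add: inner_block_vec) (simp add: inner_vec_def)
  have all_xi: "(\<forall>\<xi>::real^(1 + 'm). P \<xi>) \<longleftrightarrow> (\<forall>t v. P (block_vec (vec t) v))" for P
    by (metis block_vec_surj vec_1_surj)
  have "lp_optimal ?d ?A ?b (block_vec (vec \<gamma> :: real^1) u) \<longleftrightarrow>
      u \<in> ?U \<and> \<gamma> \<le> ?m u \<and> (\<forall>t v. v \<in> ?U \<and> t \<le> ?m v \<longrightarrow> t \<le> \<gamma>)"
    unfolding lp_optimal_def is_arg_min_linorder all_xi lp_feasible_iff cost by auto
  \<comment> \<open>Left to right, t = \<open>?m v\<close> is admissible for each v in
    \<open>?U\<close>, so \<open>?m v\<close> \<le> \<gamma>; the case v = u turns \<gamma> \<le>
    \<open>?m u\<close> into an equality. Conversely, t \<le> \<open>?m v\<close> \<le>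
    \<open>?m u\<close> = \<gamma>.\<close>
  also have "\<dots> \<longleftrightarrow> u \<in> ?U \<and> \<gamma> = ?m u \<and> (\<forall>v\<in>?U. ?m v \<le> ?m u)"
    by (blast intro: order.trans order.antisym order.refl)
  \<comment> \<open>Both \<gamma> and \<open>?m u\<close> are greatest elements of the image of
    \<open>?U\<close> under \<open>?m\<close>, so antisymmetry identifies them.\<close>
  also have "\<dots> \<longleftrightarrow> maxmin_optimal ?U B \<gamma> u"
    unfolding maxmin_optimal_def is_arg_max_linorder is_maximum_def ball_simps
    by (blast intro: order.antisym)
  finally show ?thesis .
qed

theorem proposition1:
  fixes f :: "real^'n \<Rightarrow> 'z \<Rightarrow> real^'n"
    and g :: "real^'n \<Rightarrow> real^'m^'n"
    and w :: "'o::finite \<Rightarrow> real^'p \<Rightarrow> real^'p"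
    and h \<phi> :: "'o \<Rightarrow> real^'n \<Rightarrow> real^'p \<Rightarrow> real"
    and \<alpha>0 \<alpha>1 \<alpha>2 :: "real \<Rightarrow> real"
    and a1 a2 :: real
    and x :: "real^'n" and z :: 'z and xo :: "'o \<Rightarrow> real^'p"
    and B :: "real^'m^'o"
    and U :: "(real^'m) set"
    and G :: "real^'m^'y" and l :: "real^'y"
    and d :: "real^(1 + 'm)" and A :: "real^(1 + 'm)^('y + 'o)" and b :: "real^('y + 'o)"
  assumes "class_K \<alpha>0"
    and "\<forall>k y v u. \<phi> k y v = h_dot f g (w k) (h k) z u y v + \<alpha>0 (h k y v)"
    and "\<forall>s. \<alpha>1 s = a1 * s" and "\<forall>s. \<alpha>2 s = a2 * s" and "a1 > 0" and "a2 > 0"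
    and "\<forall>k. lie_ctrl2 g (\<lambda>y. \<phi> k y (xo k)) x = 0"
    and "B = B_matrix f g \<phi> (a1 + a2) z x xo"
    and "U = {u. G *v u - l \<le> 0}" and "U \<noteq> {}" and "convex U"
    and "d = block_vec (vec (-1)) 0"
    and "A = block_mat 0 G (\<chi> i j. 1) (- B)"
    and "b = block_vec l 0"
  shows "((\<exists>\<gamma> u. maxmin_optimal U B \<gamma> u) \<longleftrightarrow> (\<exists>\<xi>. lp_optimal d A b \<xi>)) \<and>
    (\<forall>\<gamma> u. lp_optimal d A b (block_vec (vec \<gamma>) u) \<longleftrightarrow> maxmin_optimal U B \<gamma> u)"
proof -
  have iff: "lp_optimal d A b (block_vec (vec \<gamma>) u) \<longleftrightarrow> maxmin_optimal U B \<gamma> u" for \<gamma> u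
    unfolding assms(9) assms(12-14) by (rule lp_optimal_iff_maxmin_optimal)
  \<comment> \<open>Since no \<xi> lies outside the block form, an arbitrary solution of the linear
    program supplies a max-min pair, and the equivalence of existence follows from
    \<open>iff\<close>.\<close>
  have "\<exists>\<gamma> u. \<xi> = block_vec (vec \<gamma> :: real^1) u" for \<xi> :: "real^(1 + 'm)"
    by (metis block_vec_surj vec_1_surj)
  with iff show ?thesis
    by metis
qed

end
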